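(* Let $G$ be a finite simple connected graph of order $n\ge 2$. Then: (i) $eqdim(G)=1$ if and only if $\Delta(G)=n-1$; (ii) $eqdim(G)=2$ if and only if $\Delta(G)=n-2$.
   Context: All graphs are finite, simple, undirected and connected; $d(x,y)$ denotes the graph distance, and $\Delta(G)$ the maximum degree of $G$. A set $S\subseteq V(G)$ is a distance-equalizer set of $G$ if for every two distinct vertices $x,y\in V(G)\setminus S$ there is $w\in S$ with $d(x,w)=d(y,w)$. The equidistant dimension $eqdim(G)$ is the minimum cardinality of a distance-equalizer set of $G$. *)

theory Defs
  imports "Graph_Theory.Graph_Theory"
begin

(* An undirected graph is represented by its symmetric loopfree digraph without parallel arcs
   (locale graph); an undirected edge is a pair of opposite arcs. *)

(* The cost of a walk under unit weights is its number of arcs, so the infimum over all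
   u-v-walks is the graph distance; it is finite for vertices of a connected graph. *)
definition graph_dist :: "('a, 'b) pre_digraph \<Rightarrow> 'a \<Rightarrow> 'a \<Rightarrow> ereal" where
  "graph_dist G u v = wf_digraph.\<mu> G (\<lambda>_. 1) u v"

(* In a symmetric digraph without loops and parallel arcs, the out-degree of a vertex is
   its number of neighbours. *)
definition max_degree :: "('a, 'b) pre_digraph \<Rightarrow> nat" where
  "max_degree G = Max (out_degree G ` verts G)"

definition distance_equalizer :: "('a, 'b) pre_digraph \<Rightarrow> 'a set \<Rightarrow> bool" where
  "distance_equalizer G S \<longleftrightarrow> S \<subseteq> verts G \<and>
     (\<forall>x \<in> verts G - S. \<forall>y \<in> verts G - S. x \<noteq> y \<longrightarrow>
        (\<exists>w \<in> S. graph_dist G x w = graph_dist G y w))"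

(* The vertex set itself is a distance-equalizer set, so the minimum is attained
   whenever G is finite. *)
definition eqdim :: "('a, 'b) pre_digraph \<Rightarrow> nat" where
  "eqdim G = (LEAST k. \<exists>S. distance_equalizer G S \<and> card S = k)"

end

theory Submission
  imports Defs
begin

text \<open>
  Write \<open>n\<close> for the order and \<open>\<Delta>\<close> for the maximum degree. Both equivalences come from
  \<open>eqdim G + \<Delta> \<le> n\<close>, which always holds, and from equality there when \<open>eqdim G \<le> 2\<close>.

  For the bound (\<open>eqdim_plus_max_degree_le\<close>), take a vertex \<open>v\<close> of maximum degree: all its
  neighbours are at distance 1 from \<open>v\<close>, so the \<open>n - \<Delta>\<close> vertices that are not neighbours of
  \<open>v\<close>, among them \<open>v\<close>, form a distance-equalizer set.

  For the equality (\<open>eqdim_plus_max_degree_eq\<close>), let \<open>{a, b}\<close>, possibly with \<open>a = b\<close>, be a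
  distance-equalizer set. Equality of the distance to \<open>a\<close> and equality of the distance to \<open>b\<close>
  are two equivalence relations that together relate all pairs of vertices outside the set. As
  two equivalence relations can only cover all pairs if one of them does (\<open>total_fibre_relation\<close>),
  all outside vertices are at the same distance from one of the two, say \<open>a\<close>. By connectedness
  that distance is 1, and then they are all neighbours of \<open>a\<close>, or it is 2 with all shortest paths
  through \<open>b\<close>, and then they are all neighbours of \<open>b\<close>
  (\<open>card_outside_le_max_degree\<close>). Either way some vertex has degree at least \<open>n - card {a, b}\<close>.
\<close>

section \<open>Two equivalence relations covering all pairs\<close>

text \<open>
  If \<open>f\<close> separates \<open>x\<close> from \<open>y\<close>, then every \<open>z\<close> is separated by \<open>f\<close> from one of them, and
  \<open>g\<close> must take the same value at \<open>x\<close>, \<open>y\<close> and \<open>z\<close>.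
\<close>

lemma total_fibre_relation:
  assumes cover: "\<And>x y. x \<in> A \<Longrightarrow> y \<in> A \<Longrightarrow> f x = f y \<or> g x = g y"
  shows "(\<forall>x\<in>A. \<forall>y\<in>A. f x = f y) \<or> (\<forall>x\<in>A. \<forall>y\<in>A. g x = g y)"
proof (cases "\<forall>x\<in>A. \<forall>y\<in>A. f x = f y")
  case False
  then obtain x y where xy: "x \<in> A" "y \<in> A" "f x \<noteq> f y"
    by blast
  have "g z = g x" if "z \<in> A" for z
    using cover[of x y] cover[of z x] cover[of z y] xy that by metis
  then show ?thesis
    by metis
qed (rule disjI1)

section \<open>Distances up to two\<close>

lemma (in wf_digraph) graph_dist_le_iff:
  "graph_dist G u v \<le> ereal (real k) \<longleftrightarrow> (\<exists>p. awalk u p v \<and> length p \<le> k)"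
proof
  assume "graph_dist G u v \<le> ereal (real k)"
  also have "\<dots> < ereal (real (k + 1))"
    by simp
  finally obtain p where "awalk u p v" "ereal (awalk_cost (\<lambda>_. 1) p) < ereal (real (k + 1))"
    unfolding graph_dist_def \<mu>_def INF_less_iff by blast
  moreover have "awalk_cost (\<lambda>_. 1) p = real (length p)"
    by (simp add: awalk_cost_def sum_list_triv)
  ultimately show "\<exists>p. awalk u p v \<and> length p \<le> k"
    by auto
next
  assume "\<exists>p. awalk u p v \<and> length p \<le> k"
  then obtain p where p: "awalk u p v" "length p \<le> k"
    by blast
  have "graph_dist G u v \<le> ereal (awalk_cost (\<lambda>_. 1) p)"
    unfolding graph_dist_def using p(1) by (rule min_cost_le_walk_cost)
  also have "\<dots> \<le> ereal (real k)"
    using p(2) by (simp add: awalk_cost_def sum_list_triv)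
  finally show "graph_dist G u v \<le> ereal (real k)" .
qed

lemma (in wf_digraph) graph_dist_le_1_iff:
  assumes "u \<noteq> v"
  shows "graph_dist G u v \<le> 1 \<longleftrightarrow> u \<rightarrow>\<^bsub>G\<^esub> v"
proof -
  have "(\<exists>p. awalk u p v \<and> length p \<le> 1) \<longleftrightarrow> u \<rightarrow>\<^bsub>G\<^esub> v"
  proof
    assume "\<exists>p. awalk u p v \<and> length p \<le> 1"
    then obtain p where "awalk u p v" "length p \<le> 1"
      by blast
    then show "u \<rightarrow>\<^bsub>G\<^esub> v"
      using assms
      by (cases p) (auto simp: awalk_simps arcs_ends_conv)
  next
    assume "u \<rightarrow>\<^bsub>G\<^esub> v"
    then obtain e where "e \<in> arcs G" "tail G e = u" "head G e = v"
      by (rule reachableE)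
    then have "awalk u [e] v"
      using arc_implies_awalk by blast
    then show "\<exists>p. awalk u p v \<and> length p \<le> 1"
      by (intro exI[of _ "[e]"]) simp
  qed
  with graph_dist_le_iff[of u v 1] show ?thesis
    by (simp add: one_ereal_def)
qed

lemma (in wf_digraph) graph_dist_le_2I:
  assumes "u \<rightarrow>\<^bsub>G\<^esub> w" "w \<rightarrow>\<^bsub>G\<^esub> v"
  shows "graph_dist G u v \<le> 2"
proof -
  obtain e where e: "e \<in> arcs G" "tail G e = u" "head G e = w"
    using assms(1) by (rule reachableE)
  obtain f where f: "f \<in> arcs G" "tail G f = w" "head G f = v"
    using assms(2) by (rule reachableE)
  have "awalk u [e, f] v"
    using e f by (auto simp: awalk_simps)
  then have "\<exists>p. awalk u p v \<and> length p \<le> 2"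
    by (intro exI[of _ "[e, f]"]) simp
  then show ?thesis
    using graph_dist_le_iff[of u v 2] by simp
qed

lemma (in wf_digraph) graph_dist_le_2E:
  assumes "graph_dist G u v \<le> 2" "u \<noteq> v"
  obtains "u \<rightarrow>\<^bsub>G\<^esub> v" | w where "u \<rightarrow>\<^bsub>G\<^esub> w" "w \<rightarrow>\<^bsub>G\<^esub> v"
proof -
  from assms(1) obtain p where p: "awalk u p v" "length p \<le> 2"
    using graph_dist_le_iff[of u v 2] by auto
  then consider "p = []" | e where "p = [e]" | e f where "p = [e, f]"
    by (cases p rule: remdups_adj.cases) simp_all
  then show thesis
    using p(1) assms(2) that
    by cases (auto simp: awalk_simps arcs_ends_conv)
qed

lemma (in wf_digraph) graph_dist_eq_1I:
  assumes "u \<noteq> v" "u \<rightarrow>\<^bsub>G\<^esub> v"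
  shows "graph_dist G u v = 1"
proof (rule antisym)
  show "graph_dist G u v \<le> 1"
    using assms by (simp add: graph_dist_le_1_iff)
  show "1 \<le> graph_dist G u v"
    unfolding graph_dist_def \<mu>_def
  proof (rule INF_greatest)
    fix p assume "p \<in> {p. awalk u p v}"
    with assms(1) have "length p \<ge> 1"
      by (cases p) (auto simp: awalk_simps)
    then show "1 \<le> ereal (awalk_cost (\<lambda>_. 1) p)"
      by (simp add: awalk_cost_def sum_list_triv)
  qed
qed

section \<open>Degrees and connectedness\<close>

lemma (in nomulti_digraph) out_degree_eq_card_neighbours:
  "out_degree G v = card {w. v \<rightarrow>\<^bsub>G\<^esub> w}"
proof -
  have "{w. v \<rightarrow>\<^bsub>G\<^esub> w} = head G ` out_arcs G v"
    by (auto simp: arcs_ends_conv)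
  moreover have "inj_on (head G) (out_arcs G v)"
    by (auto intro!: inj_onI no_multi_arcs simp: arc_to_ends_def)
  ultimately show ?thesis
    by (simp add: out_degree_def card_image)
qed

lemma (in digraph) card_le_max_degree:
  assumes "v \<in> verts G" "\<And>w. w \<in> A \<Longrightarrow> v \<rightarrow>\<^bsub>G\<^esub> w"
  shows "card A \<le> max_degree G"
proof -
  have "card A \<le> card {w. v \<rightarrow>\<^bsub>G\<^esub> w}"
  proof (rule card_mono)
    have "{w. v \<rightarrow>\<^bsub>G\<^esub> w} \<subseteq> verts G"
      by auto
    then show "finite {w. v \<rightarrow>\<^bsub>G\<^esub> w}"
      by (rule finite_subset) simp
  qed (use assms(2) in auto)
  also have "\<dots> = out_degree G v"
    by (simp add: out_degree_eq_card_neighbours)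
  also have "\<dots> \<le> max_degree G"
    unfolding max_degree_def using assms(1) by simp
  finally show ?thesis .
qed

text \<open>
  The only property of connected graphs that the argument uses: every proper nonempty set of
  vertices is left by some edge.
\<close>

lemma (in graph) connected_leaving_edge:
  assumes "connected G" and A: "A \<subseteq> verts G" "A \<noteq> {}" "A \<noteq> verts G"
  obtains u v where "u \<in> A" "v \<in> verts G - A" "u \<rightarrow>\<^bsub>G\<^esub> v"
proof -
  obtain a z where a: "a \<in> A" and z: "z \<in> verts G" "z \<notin> A"
    using A by blast
  have "strongly_connected G"
    using assms(1) sym_arcs symmetric_connected_imp_strongly_connected by blast
  then have "a \<rightarrow>\<^sup>*\<^bsub>G\<^esub> z"
    using a z A(1) by auto
  then have "z \<in> A" if closed: "\<And>u v. u \<in> A \<Longrightarrow> u \<rightarrow>\<^bsub>G\<^esub> v \<Longrightarrow> v \<in> A"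
  proof (induction rule: reachable_induct)
    case base
    show ?case by (rule a)
  next
    case (step x y)
    then show ?case using closed by blast
  qed
  with z(2) obtain u v where "u \<in> A" "u \<rightarrow>\<^bsub>G\<^esub> v" "v \<notin> A"
    by blast
  moreover have "v \<in> verts G"
    using \<open>u \<rightarrow>\<^bsub>G\<^esub> v\<close> by (auto elim: reachableE)
  ultimately show thesis
    using that by blast
qed

section \<open>Equidistant dimension and maximum degree\<close>

lemma eqdim_le_card:
  assumes "distance_equalizer G S"
  shows "eqdim G \<le> card S"
  unfolding eqdim_def by (rule Least_le) (use assms in blast)

lemma eqdim_attained:
  obtains S where "distance_equalizer G S" "card S = eqdim G"
proof -
  have "distance_equalizer G (verts G)"
    by (simp add: distance_equalizer_def)
  then have "\<exists>S. distance_equalizer G S \<and> card S = card (verts G)"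
    by blast
  then have "\<exists>S. distance_equalizer G S \<and> card S = eqdim G"
    unfolding eqdim_def by (rule LeastI)
  with that show thesis
    by blast
qed

lemma (in fin_digraph) eqdim_ge_1:
  assumes "card (verts G) \<ge> 2"
  shows "eqdim G \<ge> 1"
proof (rule ccontr)
  assume not_ge_1: "\<not> eqdim G \<ge> 1"
  obtain S where S: "distance_equalizer G S" "card S = eqdim G"
    by (rule eqdim_attained)
  have "finite S"
    using S(1) finite_subset[OF _ finite_verts] by (simp add: distance_equalizer_def)
  moreover have "card S = 0"
    using S(2) not_ge_1 by linarith
  ultimately have "S = {}"
    by simp
  with S(1) have "\<forall>x \<in> verts G. \<forall>y \<in> verts G. x = y"
    by (simp add: distance_equalizer_def)
  then have "card (verts G) \<le> 1"
    by (simp add: card_le_Suc0_iff_eq)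
  with assms show False
    by simp
qed

lemma (in graph) eqdim_plus_max_degree_le:
  assumes "verts G \<noteq> {}"
  shows "eqdim G + max_degree G \<le> card (verts G)"
proof -
  have "max_degree G \<in> out_degree G ` verts G"
    unfolding max_degree_def using assms by (intro Max_in) auto
  then obtain v where v: "v \<in> verts G" "out_degree G v = max_degree G"
    by auto
  define N where "N = {w. v \<rightarrow>\<^bsub>G\<^esub> w}"
  have N: "N \<subseteq> verts G" "card N = max_degree G"
    using v by (auto simp: N_def out_degree_eq_card_neighbours)
  have "v \<notin> N"
    using adj_not_same by (auto simp: N_def)
  have dist_1: "graph_dist G x v = 1" if "x \<in> N" for x
  proof (rule graph_dist_eq_1I)
    show "x \<noteq> v"
      using that \<open>v \<notin> N\<close> by blast
    show "x \<rightarrow>\<^bsub>G\<^esub> v"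
      using that arcs_ends_symmetric[OF sym_arcs] by (auto simp: N_def)
  qed
  have "distance_equalizer G (verts G - N)"
    unfolding distance_equalizer_def
    using v(1) \<open>v \<notin> N\<close> dist_1 by (auto intro!: bexI[of _ v])
  then have "eqdim G \<le> card (verts G - N)"
    by (rule eqdim_le_card)
  also have "\<dots> = card (verts G) - max_degree G"
    using N by (simp add: card_Diff_subset finite_subset)
  finally show ?thesis
    using N card_mono[OF finite_verts N(1)] by simp
qed

text \<open>
  Unless there are no outside vertices, some edge leaves \<open>{a, b}\<close>. If one starts in \<open>a\<close>, the common distance to \<open>a\<close> is 1. Otherwise
  the only neighbour of \<open>a\<close> is \<open>b\<close>, and the common distance is at most 2, as witnessed by an
  outside neighbour of \<open>b\<close>; so every path of length at most 2 to \<open>a\<close> from outside goes through \<open>b\<close>.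
\<close>

lemma (in graph) card_outside_le_max_degree:
  assumes conn: "connected G" and ab: "a \<in> verts G" "b \<in> verts G"
    and same: "\<forall>x \<in> verts G - {a, b}. \<forall>y \<in> verts G - {a, b}. graph_dist G x a = graph_dist G y a"
  shows "card (verts G - {a, b}) \<le> max_degree G"
proof (cases "verts G = {a, b}")
  case False
  note symm = arcs_ends_symmetric[OF sym_arcs]
  obtain u x where ux: "u \<in> {a, b}" "x \<in> verts G - {a, b}" "u \<rightarrow>\<^bsub>G\<^esub> x"
    using connected_leaving_edge[OF conn, of "{a, b}"] ab False by blast
  show ?thesis
  proof (cases "\<exists>z \<in> verts G - {a, b}. a \<rightarrow>\<^bsub>G\<^esub> z")
    case True
    then obtain z where z: "z \<in> verts G - {a, b}" "a \<rightarrow>\<^bsub>G\<^esub> z"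
      by blast
    have "a \<rightarrow>\<^bsub>G\<^esub> y" if "y \<in> verts G - {a, b}" for y
    proof -
      have "graph_dist G z a \<le> 1"
        using z symm graph_dist_le_1_iff by blast
      then have "graph_dist G y a \<le> 1"
        using same z(1) that by metis
      then show ?thesis
        using that symm graph_dist_le_1_iff by blast
    qed
    with ab(1) show ?thesis
      by (rule card_le_max_degree)
  next
    case no_edge: False
    with ux have "u = b" "b \<rightarrow>\<^bsub>G\<^esub> x"
      by auto
    have only_b: "w = b" if "a \<rightarrow>\<^bsub>G\<^esub> w" for w
    proof -
      have "w \<in> verts G"
        using that by auto
      moreover have "w \<noteq> a"
        using that adj_not_same by blast
      ultimately show ?thesis
        using that no_edge by blast
    qed
    have "verts G \<noteq> {a}"
      using ux by blast
    then obtain w where "a \<rightarrow>\<^bsub>G\<^esub> w"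
      using connected_leaving_edge[OF conn, of "{a}"] ab(1) by blast
    with only_b have "b \<rightarrow>\<^bsub>G\<^esub> a"
      using symm by blast
    have "b \<rightarrow>\<^bsub>G\<^esub> y" if y: "y \<in> verts G - {a, b}" for y
    proof -
      have "graph_dist G x a \<le> 2"
        using \<open>b \<rightarrow>\<^bsub>G\<^esub> x\<close> \<open>b \<rightarrow>\<^bsub>G\<^esub> a\<close> symm graph_dist_le_2I by blast
      then have "graph_dist G y a \<le> 2"
        using same ux(2) y by metis
      moreover have "y \<noteq> a"
        using y by blast
      ultimately show ?thesis
      proof (cases rule: graph_dist_le_2E)
        case 1
        with y no_edge symm show ?thesis by blast
      next
        case (2 w)
        with only_b symm show ?thesis by blast
      qed
    qed
    with ab(2) show ?thesis
      by (rule card_le_max_degree)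
  qed
qed simp

lemma (in graph) eqdim_plus_max_degree_eq:
  assumes conn: "connected G" and n: "card (verts G) \<ge> 2" and le_2: "eqdim G \<le> 2"
  shows "eqdim G + max_degree G = card (verts G)"
proof (rule antisym)
  show "eqdim G + max_degree G \<le> card (verts G)"
    using n by (intro eqdim_plus_max_degree_le) auto
next
  obtain S where S: "distance_equalizer G S" "card S = eqdim G"
    by (rule eqdim_attained)
  have "card S = 1 \<or> card S = 2"
    using S(2) le_2 eqdim_ge_1[OF n] by linarith
  then obtain a b where S_eq: "S = {a, b}"
    by (metis card_1_singletonE card_2_iff insert_absorb2)
  have ab: "a \<in> verts G" "b \<in> verts G"
    using S(1) by (auto simp: S_eq distance_equalizer_def)
  have "graph_dist G x a = graph_dist G y a \<or> graph_dist G x b = graph_dist G y b"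
    if "x \<in> verts G - {a, b}" "y \<in> verts G - {a, b}" for x y
    using S(1) that unfolding distance_equalizer_def S_eq by (cases "x = y") auto
  then have "(\<forall>x \<in> verts G - {a, b}. \<forall>y \<in> verts G - {a, b}. graph_dist G x a = graph_dist G y a)
      \<or> (\<forall>x \<in> verts G - {a, b}. \<forall>y \<in> verts G - {a, b}. graph_dist G x b = graph_dist G y b)"
    by (rule total_fibre_relation)
  then have "card (verts G - S) \<le> max_degree G"
  proof
    assume "\<forall>x \<in> verts G - {a, b}. \<forall>y \<in> verts G - {a, b}. graph_dist G x a = graph_dist G y a"
    then show ?thesis
      unfolding S_eq by (rule card_outside_le_max_degree[OF conn ab])
  next
    assume "\<forall>x \<in> verts G - {a, b}. \<forall>y \<in> verts G - {a, b}. graph_dist G x b = graph_dist G y b"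
    then show ?thesis
      unfolding S_eq insert_commute[of a b]
      by (rule card_outside_le_max_degree[OF conn ab(2) ab(1)])
  qed
  moreover have "card (verts G - S) = card (verts G) - card S"
    using ab by (intro card_Diff_subset) (auto simp: S_eq)
  ultimately show "card (verts G) \<le> eqdim G + max_degree G"
    using S(2) by simp
qed

theorem theorem4:
  fixes G :: "('a, 'b) pre_digraph" and n :: nat
  assumes "Digraph.graph G"
    and "Digraph_Component.connected G"
    and "n = card (verts G)"
    and "n \<ge> 2"
  shows "(eqdim G = 1 \<longleftrightarrow> max_degree G = n - 1) \<and>
         (eqdim G = 2 \<longleftrightarrow> max_degree G = n - 2)"
proof -
  have G: "fin_digraph G"
    using assms(1) by (simp add: graph_def digraph_def)
  have le: "eqdim G + max_degree G \<le> n"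
    using graph.eqdim_plus_max_degree_le[OF assms(1)] assms(3,4) by fastforce
  have eq: "eqdim G + max_degree G = n" if "eqdim G \<le> 2"
    using graph.eqdim_plus_max_degree_eq[OF assms(1,2) _ that] assms(3,4) by blast
  have pos: "eqdim G \<ge> 1"
    using fin_digraph.eqdim_ge_1[OF G] assms(3,4) by blast
  show ?thesis
  proof (cases "eqdim G \<le> 2")
    case True
    with eq pos assms(4) show ?thesis
      by presburger
  next
    case False
    with le assms(4) show ?thesis
      by presburger
  qed
qed

end
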